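(* Let $\alpha,\beta\in\mathbb{C}$ with $\Re(\alpha)>0$ and $\Re(\beta)>0$, let $M$ be a positive finite real number, and let $m\in\mathbb{C}$ with $|m|<M$. Then the modified extension of the classical beta function $$B(\alpha,\beta;m)=\int_0^1 t^{\alpha-1}(1-t)^{\beta-1}e^{mt(1-t)}\,dt$$ is convergent.
   Context: For $0<t<1$ and complex $\alpha$, $t^{\alpha-1}=e^{(\alpha-1)\log t}$ with the real logarithm, and similarly for $(1-t)^{\beta-1}$. *)

theory Defs
  imports "HOL-Analysis.Analysis"
begin

text \<open>
  Convergence of an integral over the open interval from \<open>a\<close> to \<open>b\<close>, improper at both
  endpoints: \<open>f\<close> is integrable on every compact subinterval, and the integrals over
  \<open>{c..d}\<close> tend to \<open>I\<close> as \<open>c\<close> decreases to \<open>a\<close> and \<open>d\<close> increases to \<open>b\<close> independently.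
  Convergence is conditional, i.e. absolute integrability is not demanded.
\<close>

definition has_improper_integral ::
    "(real \<Rightarrow> 'a :: real_normed_vector) \<Rightarrow> real \<Rightarrow> real \<Rightarrow> 'a \<Rightarrow> bool" where
  "has_improper_integral f a b I \<longleftrightarrow>
     (\<forall>c d. a < c \<and> c \<le> d \<and> d < b \<longrightarrow> f integrable_on {c..d}) \<and>
     ((\<lambda>(c, d). integral {c..d} f) \<longlongrightarrow> I) (at_right a \<times>\<^sub>F at_left b)"

definition improper_integral_convergent ::
    "(real \<Rightarrow> 'a :: real_normed_vector) \<Rightarrow> real \<Rightarrow> real \<Rightarrow> bool" where
  "improper_integral_convergent f a b \<longleftrightarrow> (\<exists>I. has_improper_integral f a b I)"

definition improper_integral ::
    "(real \<Rightarrow> 'a :: real_normed_vector) \<Rightarrow> real \<Rightarrow> real \<Rightarrow> 'a" where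
  "improper_integral f a b = (THE I. has_improper_integral f a b I)"

lemma has_improper_integral_unique:
  assumes "has_improper_integral f a b I" "has_improper_integral f a b J"
  shows   "I = J"
  using assms unfolding has_improper_integral_def
  by (intro tendsto_unique[of "at_right a \<times>\<^sub>F at_left b"]) (auto simp: prod_filter_eq_bot)

lemma improper_integral_eqI:
  "has_improper_integral f a b I \<Longrightarrow> improper_integral f a b = I"
  unfolding improper_integral_def by (blast intro: has_improper_integral_unique)

lemma improper_integral_convergent_iff:
  "improper_integral_convergent f a b \<longleftrightarrow> has_improper_integral f a b (improper_integral f a b)"
  unfolding improper_integral_convergent_def by (metis improper_integral_eqI)

definition ext_beta_integrand :: "complex \<Rightarrow> complex \<Rightarrow> complex \<Rightarrow> real \<Rightarrow> complex" where
  "ext_beta_integrand \<alpha> \<beta> m t =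
     of_real t powr (\<alpha> - 1) * of_real (1 - t) powr (\<beta> - 1) * exp (m * of_real t * of_real (1 - t))"

text \<open>On the range of integration the complex powers are taken with the real logarithm.\<close>

lemma ext_beta_integrand_eq:
  assumes "0 < t" "t < 1"
  shows   "ext_beta_integrand \<alpha> \<beta> m t =
             exp ((\<alpha> - 1) * of_real (ln t)) * exp ((\<beta> - 1) * of_real (ln (1 - t))) *
             exp (m * of_real t * of_real (1 - t))"
  using assms Ln_of_real[of t] Ln_of_real[of "1 - t"]
  by (simp add: ext_beta_integrand_def powr_def)

definition ext_beta :: "complex \<Rightarrow> complex \<Rightarrow> complex \<Rightarrow> complex" where
  "ext_beta \<alpha> \<beta> m = improper_integral (ext_beta_integrand \<alpha> \<beta> m) 0 1"

end

theory Submission imports Defs begin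

text \<open>
  On the open unit interval the exponential factor of the integrand is bounded by
  \<open>exp (norm m)\<close>, because \<open>t * (1 - t)\<close> lies between \<open>0\<close> and \<open>1\<close>. What remains of the
  modulus is the integrand of the real Beta integral with parameters \<open>Re \<alpha>\<close> and \<open>Re \<beta>\<close>, which
  is integrable since both are positive. Domination (lemma \<open>ext_beta_integrand_integrable\<close>)
  therefore gives integrability over the whole of \<open>{0..1}\<close>, and the integral of an integrable
  function depends continuously on the endpoints, so the improper integral converges to the
  proper one (lemma \<open>has_improper_integral_integral\<close>).
\<close>

text \<open>
  For \<open>F x = integral {a..x} f\<close>, which is continuous on \<open>{a..b}\<close>, the integral over \<open>{c..d}\<close> is
  \<open>F d - F c\<close>; the limits at the two endpoints can then be taken independently.
\<close>

lemma has_improper_integral_integral: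
  fixes f :: "real \<Rightarrow> 'a :: banach"
  assumes "a < b" and f: "f integrable_on {a..b}"
  shows   "has_improper_integral f a b (integral {a..b} f)"
  unfolding has_improper_integral_def
proof (intro conjI allI impI)
  show "f integrable_on {c..d}" if "a < c \<and> c \<le> d \<and> d < b" for c d
    by (rule integrable_subinterval_real[OF f]) (use that in auto)
next
  define F where "F = (\<lambda>x. integral {a..x} f)"
  have cont: "continuous_on {a..b} F"
    unfolding F_def by (rule indefinite_integral_continuous_1[OF f])
  have "(F \<longlongrightarrow> F b) (at_left b)" "(F \<longlongrightarrow> F a) (at_right a)"
    using continuous_on_Icc_at_leftD[OF cont \<open>a < b\<close>]
      continuous_on_Icc_at_rightD[OF cont \<open>a < b\<close>] by auto
  then have "((\<lambda>p. F (snd p) - F (fst p)) \<longlongrightarrow> F b - F a) (at_right a \<times>\<^sub>F at_left b)"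
    by (intro tendsto_diff filterlim_compose[OF _ filterlim_snd]
          filterlim_compose[OF _ filterlim_fst])
  moreover have "\<forall>\<^sub>F p in at_right a \<times>\<^sub>F at_left b.
      F (snd p) - F (fst p) = (case p of (c, d) \<Rightarrow> integral {c..d} f)"
  proof -
    \<comment> \<open>The midpoint separates the two endpoints, so that eventually \<open>c \<le> d\<close>.\<close>
    define z where "z = (a + b) / 2"
    have z: "a < z" "z < b"
      using \<open>a < b\<close> by (auto simp: z_def)
    have "\<forall>\<^sub>F p in at_right a \<times>\<^sub>F at_left b. fst p \<in> {a<..<z} \<and> snd p \<in> {z<..<b}"
      using eventually_prodI[OF eventually_at_right_real[OF z(1)] eventually_at_left_real[OF z(2)]] .
    then show ?thesis
    proof eventually_elim
      case (elim p)
      obtain c d where p: "p = (c, d)"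
        by (cases p)
      have "f integrable_on {a..d}"
        by (rule integrable_subinterval_real[OF f]) (use elim p in auto)
      then have "integral {a..c} f + integral {c..d} f = integral {a..d} f"
        using elim p by (intro Henstock_Kurzweil_Integration.integral_combine) auto
      then show ?case
        by (simp add: p F_def algebra_simps)
    qed
  qed
  ultimately have "((\<lambda>(c, d). integral {c..d} f) \<longlongrightarrow> F b - F a) (at_right a \<times>\<^sub>F at_left b)"
    by (rule Lim_transform_eventually)
  then show "((\<lambda>(c, d). integral {c..d} f) \<longlongrightarrow> integral {a..b} f) (at_right a \<times>\<^sub>F at_left b)"
    by (simp add: F_def)
qed

lemma norm_ext_beta_integrand_le:
  assumes "0 < t" "t < 1"
  shows   "norm (ext_beta_integrand \<alpha> \<beta> m t) \<le>
             exp (norm m) * (t powr (Re \<alpha> - 1) * (1 - t) powr (Re \<beta> - 1))"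
proof -
  have "norm (m * of_real t * of_real (1 - t)) = norm m * (t * (1 - t))"
    using assms by (simp only: norm_mult norm_of_real)
  also have "\<dots> \<le> norm m * 1"
    using assms mult_le_one[of t "1 - t"] by (intro mult_left_mono) auto
  finally have *: "norm (exp (m * of_real t * of_real (1 - t))) \<le> exp (norm m)"
    by (intro order_trans[OF norm_exp]) simp
  have "norm (complex_of_real t powr (\<alpha> - 1)) = t powr (Re \<alpha> - 1)"
    "norm (complex_of_real (1 - t) powr (\<beta> - 1)) = (1 - t) powr (Re \<beta> - 1)"
    using assms by (simp_all only: norm_powr_real_powr Reals_of_real Re_complex_of_real minus_complex.sel one_complex.sel)
  then have "norm (ext_beta_integrand \<alpha> \<beta> m t) = t powr (Re \<alpha> - 1) * (1 - t) powr (Re \<beta> - 1) *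
      norm (exp (m * of_real t * of_real (1 - t)))"
    unfolding ext_beta_integrand_def norm_mult by simp
  also have "\<dots> \<le> t powr (Re \<alpha> - 1) * (1 - t) powr (Re \<beta> - 1) * exp (norm m)"
    by (intro mult_left_mono *) auto
  finally show ?thesis
    by (simp add: mult_ac)
qed

text \<open>
  The domination argument runs on the open interval, where the integrand is continuous; the
  endpoints, at which it may be discontinuous, form a null set.
\<close>

lemma ext_beta_integrand_integrable:
  assumes "Re \<alpha> > 0" and "Re \<beta> > 0"
  shows   "ext_beta_integrand \<alpha> \<beta> m integrable_on {0..1}"
proof -
  have "ext_beta_integrand \<alpha> \<beta> m absolutely_integrable_on {0<..<1}"
  proof (rule measurable_bounded_by_integrable_imp_absolutely_integrable)
    have "continuous_on {0<..<1} (ext_beta_integrand \<alpha> \<beta> m)"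
      unfolding ext_beta_integrand_def
      by (intro continuous_intros) (auto simp: complex_nonpos_Reals_iff)
    then show "ext_beta_integrand \<alpha> \<beta> m \<in> borel_measurable (lebesgue_on {0<..<1})"
      by (rule continuous_imp_measurable_on_sets_lebesgue) auto
    show "(\<lambda>t. exp (norm m) * (t powr (Re \<alpha> - 1) * (1 - t) powr (Re \<beta> - 1)))
        integrable_on {0<..<1}"
      using integrable_on_open_interval_real integrable_Beta'[OF assms]
      by (intro integrable_on_mult_right) auto
  qed (auto intro: norm_ext_beta_integrand_le)
  then show ?thesis
    using integrable_on_open_interval_real set_lebesgue_integral_eq_integral(1) by blast
qed

theorem theorem1:
  fixes \<alpha> \<beta> m :: complex and M :: real
  assumes "Re \<alpha> > 0" and "Re \<beta> > 0"
    and "M > 0" and "norm m < M"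
  shows "improper_integral_convergent (ext_beta_integrand \<alpha> \<beta> m) 0 1 \<and>
         has_improper_integral (ext_beta_integrand \<alpha> \<beta> m) 0 1 (ext_beta \<alpha> \<beta> m)"
proof -
  have "improper_integral_convergent (ext_beta_integrand \<alpha> \<beta> m) 0 1"
    using has_improper_integral_integral[OF _ ext_beta_integrand_integrable[OF assms(1,2)]]
    unfolding improper_integral_convergent_def by force
  then show ?thesis
    unfolding ext_beta_def by (simp add: improper_integral_convergent_iff)
qed

end
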